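(* There exist a finite LCM closed set $S=\{x_1,\ldots,x_n\}$ of distinct odd positive integers and a real number $\alpha\neq 0$ such that the $n\times n$ power LCM matrix whose $(i,j)$-entry is $\mathrm{lcm}(x_i,x_j)^{\alpha}$ is singular.
   Context: A finite set $S$ of positive integers is LCM closed if $\mathrm{lcm}(a,b)\in S$ for all $a,b\in S$. *)

theory Defs
  imports Complex_Main "Jordan_Normal_Form.Matrix"
begin

definition lcm_closed :: "nat set \<Rightarrow> bool" where
  "lcm_closed S \<longleftrightarrow> finite S \<and> (\<forall>a\<in>S. 0 < a) \<and> (\<forall>a\<in>S. \<forall>b\<in>S. lcm a b \<in> S)"

(* Rows and columns are indexed by {0..<n}, so the set is {x 0, ..., x (n - 1)}. *)
definition power_lcm_mat :: "nat \<Rightarrow> (nat \<Rightarrow> nat) \<Rightarrow> real \<Rightarrow> real mat" where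
  "power_lcm_mat n x \<alpha> = mat n n (\<lambda>(i, j). real (lcm (x i) (x j)) powr \<alpha>)"

end

(* For an lcm-closed set {1, a, b, lcm a b} the power LCM matrix kills the vector of Moebius values
   (1, -1, -1, 1) as soon as g(t) = 1 - a^t - b^t + (lcm a b)^t vanishes.  If gcd a b > 1 then g has
   negative slope at its trivial zero t = 0, while g tends to infinity when neither of a, b divides
   the other, so g has a second zero.  With a = 3 * 15^2 and b = 5 * 15^2 the sign change of g is
   already visible between t = 1/2 and t = 1. *)
theory Submission
  imports Defs
begin

lemma not_invertible_mat_if_kernel:
  fixes A :: "'a :: semiring_1 mat"
  assumes A: "A \<in> carrier_mat n n" and v: "v \<in> carrier_vec n" "v \<noteq> 0\<^sub>v n"
    and ker: "A *\<^sub>v v = 0\<^sub>v n"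
  shows "\<not> invertible_mat A"
proof
  assume "invertible_mat A"
  then obtain B where AB: "A * B = 1\<^sub>m (dim_row A)" and BA: "B * A = 1\<^sub>m (dim_row B)"
    unfolding invertible_mat_def inverts_mat_def by blast
  \<comment> \<open>\<open>invertible_mat\<close> does not state the size of \<open>B\<close>.
    Comparing column counts in \<open>B * A = 1\<close> gives \<open>dim_row B\<close>, and in
    \<open>A * B = 1\<close> gives \<open>dim_col B\<close>.\<close>
  have "dim_row B = n" "dim_col B = n"
    using arg_cong[OF BA, of dim_col] arg_cong[OF AB, of dim_col] A by auto
  then have B: "B \<in> carrier_mat n n"
    by blast
  have "v = (B * A) *\<^sub>v v"
    using BA B v(1) by auto
  also have "\<dots> = B *\<^sub>v 0\<^sub>v n"
    using A B v(1) by (simp add: assoc_mult_mat_vec[of _ n n _ n] ker)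
  also have "\<dots> = 0\<^sub>v n"
    using B by auto
  finally show False
    using v(2) by simp
qed

lemma power_lcm_mat_singular:
  assumes "1 - real a powr \<alpha> - real b powr \<alpha> + real (lcm a b) powr \<alpha> = 0"
  shows "\<not> invertible_mat (power_lcm_mat 4 ((!) [1, a, b, lcm a b]) \<alpha>)"
proof (rule not_invertible_mat_if_kernel)
  let ?x = "(!) [1, a, b, lcm a b]" and ?v = "vec_of_list [1, -1, -1, 1 :: real]"
  show "power_lcm_mat 4 ?x \<alpha> \<in> carrier_mat 4 4"
    by (simp add: power_lcm_mat_def)
  show "?v \<in> carrier_vec 4"
    by (intro carrier_vecI) simp
  have "?v $ 0 \<noteq> 0\<^sub>v 4 $ 0"
    by simp
  then show "?v \<noteq> 0\<^sub>v 4"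
    by metis
  show "power_lcm_mat 4 ?x \<alpha> *\<^sub>v ?v = 0\<^sub>v 4"
  proof (rule eq_vecI)
    fix i assume "i < dim_vec (0\<^sub>v 4 :: real vec)"
    then have i: "i \<in> {0, 1, 2, 3}" "i < 4"
      by auto
    have "(power_lcm_mat 4 ?x \<alpha> *\<^sub>v ?v) $ i
        = real (lcm (?x i) 1) powr \<alpha> - real (lcm (?x i) a) powr \<alpha>
          - real (lcm (?x i) b) powr \<alpha> + real (lcm (?x i) (lcm a b)) powr \<alpha>"
      using i(2) by (simp add: power_lcm_mat_def scalar_prod_def vec_of_list_index)
    \<comment> \<open>Only row 0 needs the assumption, being exactly its left-hand side. In the
      other rows \<open>a\<close> or \<open>b\<close> divides the row's entry of the list, so the
      four lcms agree in pairs of opposite sign and cancel.\<close>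
    also have "\<dots> = 0"
    proof -
      have "lcm b a = lcm a b" "lcm b (lcm a b) = lcm a b" "lcm (lcm a b) a = lcm a b"
        by (simp_all add: lcm.commute)
      then show ?thesis
        using i(1) assms by auto
    qed
    finally show "(power_lcm_mat 4 ?x \<alpha> *\<^sub>v ?v) $ i = 0\<^sub>v 4 $ i"
      using i(2) by simp
  qed (simp add: power_lcm_mat_def)
qed

text \<open>Here 3375 = 15^3 is the lcm of 675 = 3 * 15^2 and 1125 = 5 * 15^2. The intermediate
  value theorem is applied on [1/2, 1], which excludes the trivial zero at 0.\<close>

lemma ex_exponent:
  "\<exists>\<alpha>>0. 1 - 675 powr \<alpha> - 1125 powr \<alpha> + 3375 powr \<alpha> = (0 :: real)"
proof -
  define g :: "real \<Rightarrow> real" where "g t = 1 - 675 powr t - 1125 powr t + 3375 powr t" for t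
  \<comment> \<open>These bounds give g(1/2) < 1 - 25.98 - 33.54 + 58.1 = -0.42.\<close>
  have "sqrt 675 > 25.98" "sqrt 1125 > 33.54" "sqrt 3375 < 58.1"
    by (rule real_less_rsqrt real_less_lsqrt; simp add: power2_eq_square)+
  then have "g (1/2) \<le> 0"
    by (simp add: g_def powr_half_sqrt)
  moreover have "0 \<le> g 1"
    by (simp add: g_def)
  moreover have "continuous_on {1/2..1} g"
    unfolding g_def by (intro continuous_intros) auto
  ultimately obtain t where "1/2 \<le> t" "g t = 0"
    using IVT'[of g "1/2" 0 1] by auto
  then show ?thesis
    unfolding g_def by (intro exI[of _ t]) auto
qed

theorem mainTheorem7:
  shows "\<exists>(S :: nat set) (n :: nat) (x :: nat \<Rightarrow> nat) (\<alpha> :: real).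
    lcm_closed S \<and> (\<forall>a\<in>S. odd a) \<and> bij_betw x {0..<n} S \<and> \<alpha> \<noteq> 0 \<and>
    \<not> invertible_mat (power_lcm_mat n x \<alpha>)"
proof -
  \<comment> \<open>The last entry stays an unevaluated lcm so that the list matches
    \<open>power_lcm_mat_singular\<close>.\<close>
  let ?l = "[1, 675, 1125, lcm 675 1125 :: nat]"
  obtain \<alpha> :: real where \<alpha>: "\<alpha> > 0" "1 - 675 powr \<alpha> - 1125 powr \<alpha> + 3375 powr \<alpha> = 0"
    using ex_exponent by blast
  have lcm: "lcm 675 1125 = (3375 :: nat)"
    by (simp add: lcm_nat_def gcd_non_0_nat)
  have "lcm_closed (set ?l)"
    unfolding lcm_closed_def by (auto simp: lcm_nat_def gcd_non_0_nat)
  moreover have "\<forall>a\<in>set ?l. odd a"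
    by (simp add: lcm)
  moreover have "bij_betw ((!) ?l) {0..<4} (set ?l)"
    by (rule bij_betw_nth) (auto simp: lcm)
  moreover have "\<not> invertible_mat (power_lcm_mat 4 ((!) ?l) \<alpha>)"
    using \<alpha>(2) by (intro power_lcm_mat_singular) (simp add: lcm)
  ultimately show ?thesis
    using \<alpha>(1)
    by (intro exI[of _ "set ?l"] exI[of _ 4] exI[of _ "(!) ?l"] exI[of _ \<alpha>] conjI) (assumption | rule less_imp_neq[symmetric])+
qed

end
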